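(* In the disclosure game described in the context, if every connected set in $E$ has finitely many minimal elements, then an equilibrium exists.
   Context: Disclosure game. A state $\omega\in\{G,B\}$ is drawn with prior probability $\pi_0\in(0,1)$ on $G$. The evidence space $E$ is a finite or countably infinite set; $F_G,F_B$ are probability distributions on $E$ such that for every $e\in E$ at least one of $F_G(e),F_B(e)$ is strictly positive. The sender privately observes evidence $e\in E$ drawn from $F_\omega$. A disclosure rule is a preorder $\precsim$ on $E$ (reflexive and transitive) satisfying: for every sequence $e_1\succsim e_2\succsim\cdots$ in $E$ there is $N\ge1$ with $e_N\precsim e_n$ for all $n\ge N$. Write $e\sim e'$ if $e\precsim e'$ and $e'\precsim e$. The sender with evidence $e$ sends a message $m\in E$ with $m\precsim e$. The receiver observes $m$ and takes an action $a\in\mathbb{R}$; for every $\mu\in[0,1]$ the problem $\max_a \mu u_R(a,G)+(1-\mu)u_R(a,B)$ has a unique solution $\phi(\mu)$, with $\phi:[0,1]\to\mathbb{R}$ strictly increasing. The sender's payoff is $a$. Notation: $LC(e)=\{m:m\precsim e\}$, $UC(m)=\{e:m\precsim e\}$, $\nu(A)=\frac{F_G(A)\pi_0}{F_G(A)\pi_0+F_B(A)(1-\pi_0)}$ for nonempty $A\subset E$, $\nu(e)=\nu(\{e\})$. A (truth-leaning) equilibrium is a triple $(\sigma^\star,\mathbf{a}^\star,\mu)$ with $\sigma^\star:E\to\Delta(E)$, $\mathrm{supp}\,\sigma^\star(\cdot|e)\subset LC(e)$, $\mathbf{a}^\star:E\to\mathbb{R}$, $\mu:E\to[0,1]$, such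 that: (i) $\mathrm{supp}\,\sigma^\star(\cdot|e)\subset\arg\max_{m\precsim e}\mathbf{a}^\star(m)$ for all $e$; (ii) $\mathbf{a}^\star=\phi\circ\mu$; (iii) for every on-path message $m$ (i.e. $m\in\mathrm{supp}\,\sigma^\star(\cdot|e)$ for some $e$), $\mu(m)=\frac{\sum_{e\in UC(m)}\sigma^\star(m|e)F_G(e)\pi_0}{\sum_{e\in UC(m)}\sigma^\star(m|e)[F_G(e)\pi_0+F_B(e)(1-\pi_0)]}$; (iv) if $e\in\arg\max_{m\precsim e}\mathbf{a}^\star(m)$ then $\sigma^\star(e|e)=1$; (v) for every off-path message $m$, $\mu(m)=\nu(m)$. A set $A\subset E$ is connected if for all $e,e'\in A$ there is a finite sequence $e_0=e,e_1,\dots,e_N=e'$ in $A$ such that for each $k$, $e_k\precsim e_{k+1}$ or $e_k\succsim e_{k+1}$. The minimal elements of $A$ are $\min(A,\precsim)=\{e\in A:\forall e'\in A,\ e'\precsim e\Rightarrow e'\sim e\}$. *)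

theory Defs
  imports "HOL-Probability.Probability"
begin

datatype state = G | B

definition exp_util :: "(real \<Rightarrow> state \<Rightarrow> real) \<Rightarrow> real \<Rightarrow> real \<Rightarrow> real" where
  "exp_util uR mu a = mu * uR a G + (1 - mu) * uR a B"

definition phi :: "(real \<Rightarrow> state \<Rightarrow> real) \<Rightarrow> real \<Rightarrow> real" where
  "phi uR mu = (THE a. \<forall>a'. exp_util uR mu a' \<le> exp_util uR mu a)"

definition disclosure_rule :: "('e \<Rightarrow> 'e \<Rightarrow> bool) \<Rightarrow> bool" where
  "disclosure_rule le \<longleftrightarrow>
     (\<forall>e. le e e) \<and> (\<forall>x y z. le x y \<longrightarrow> le y z \<longrightarrow> le x z) \<and>
     (\<forall>s :: nat \<Rightarrow> 'e. (\<forall>n. le (s (Suc n)) (s n)) \<longrightarrow>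
        (\<exists>N. \<forall>n\<ge>N. le (s N) (s n)))"

definition nu :: "real \<Rightarrow> 'e pmf \<Rightarrow> 'e pmf \<Rightarrow> 'e set \<Rightarrow> real" where
  "nu pi0 FG FB A = measure_pmf.prob FG A * pi0 /
      (measure_pmf.prob FG A * pi0 + measure_pmf.prob FB A * (1 - pi0))"

definition on_path :: "('e \<Rightarrow> 'e pmf) \<Rightarrow> 'e \<Rightarrow> bool" where
  "on_path sg m \<longleftrightarrow> (\<exists>e. m \<in> set_pmf (sg e))"

definition equilibrium ::
  "real \<Rightarrow> 'e pmf \<Rightarrow> 'e pmf \<Rightarrow> ('e \<Rightarrow> 'e \<Rightarrow> bool) \<Rightarrow> (real \<Rightarrow> state \<Rightarrow> real)
   \<Rightarrow> ('e \<Rightarrow> 'e pmf) \<Rightarrow> ('e \<Rightarrow> real) \<Rightarrow> ('e \<Rightarrow> real) \<Rightarrow> bool" where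
  "equilibrium pi0 FG FB le uR sg astar mu \<longleftrightarrow>
     (\<forall>e. \<forall>m \<in> set_pmf (sg e). le m e) \<and>
     (\<forall>e. \<forall>m \<in> set_pmf (sg e). \<forall>m'. le m' e \<longrightarrow> astar m' \<le> astar m) \<and>
     (\<forall>m. mu m \<in> {0..1}) \<and>
     (\<forall>m. astar m = phi uR (mu m)) \<and>
     (\<forall>m. on_path sg m \<longrightarrow>
        mu m = (\<Sum>\<^sub>\<infinity>e\<in>{e. le m e}. pmf (sg e) m * pmf FG e * pi0) /
               (\<Sum>\<^sub>\<infinity>e\<in>{e. le m e}. pmf (sg e) m * (pmf FG e * pi0 + pmf FB e * (1 - pi0)))) \<and>
     (\<forall>e. (\<forall>m. le m e \<longrightarrow> astar m \<le> astar e) \<longrightarrow> pmf (sg e) e = 1) \<and>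
     (\<forall>m. \<not> on_path sg m \<longrightarrow> mu m = nu pi0 FG FB {m})"

definition connected_pre :: "('e \<Rightarrow> 'e \<Rightarrow> bool) \<Rightarrow> 'e set \<Rightarrow> bool" where
  "connected_pre le A \<longleftrightarrow>
     (\<forall>e\<in>A. \<forall>e'\<in>A. (\<lambda>x y. x \<in> A \<and> y \<in> A \<and> (le x y \<or> le y x))\<^sup>*\<^sup>* e e')"

definition minimal_elems :: "('e \<Rightarrow> 'e \<Rightarrow> bool) \<Rightarrow> 'e set \<Rightarrow> 'e set" where
  "minimal_elems le A = {e \<in> A. \<forall>e'\<in>A. le e' e \<longrightarrow> le e e'}"

end

theory Submission
  imports Defs
begin

text \<open>
  Write \<open>g e\<close> for the mass of evidence \<open>e\<close> in the good state and \<open>w e\<close> for its total mass.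
  A flow \<open>y (e, m) \<ge> 0\<close> with \<open>m \<precsim> e\<close> moves the belief at \<open>e\<close> up and that at \<open>m\<close> down, to
  \<open>v e = (g e + outflow e - inflow e) / w e\<close>. Bounding in- and outflow by \<open>w\<close> makes the set of flows
  compact in the product topology, and all sums converge uniformly on it because \<open>w\<close> is summable.
  Among the flows minimising \<open>\<Sum> w e * (v e)\<^sup>2\<close> take one of least total volume. The first-order
  conditions say that \<open>v\<close> is monotone and constant along the flow (it is the isotonic regression of
  \<open>g / w\<close>); least volume says that no evidence both receives and emits. Evidence without outflow
  is disclosed truthfully, evidence \<open>e\<close> with outflow sends \<open>m\<close> with probability
  \<open>y (e, m) / outflow e\<close>, and Bayes' rule returns exactly \<open>v m\<close> at every message sent.
\<close>

section \<open>Compactness and dominated sums in function spaces\<close>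

lemma compact_function_box:
  fixes l u :: "'a \<Rightarrow> real"
  shows "compact {y. \<forall>p. l p \<le> y p \<and> y p \<le> u p}"
proof -
  \<comment> \<open>Tychonoff: the topology on functions is the product topology, so a product of
    compact intervals is compact.\<close>
  have "compactin (product_topology (\<lambda>i::'a. euclidean) UNIV) (PiE UNIV (\<lambda>p. {l p..u p}))"
    by (subst compactin_PiE) auto
  moreover have "PiE UNIV (\<lambda>p. {l p..u p}) = {y. \<forall>p. l p \<le> y p \<and> y p \<le> u p}"
    by (auto simp: PiE_def Pi_def)
  ultimately show ?thesis by (simp add: euclidean_product_topology)
qed

lemma closed_function_box:
  fixes l u :: "'a \<Rightarrow> real"
  shows "closed {y. \<forall>p. l p \<le> y p \<and> y p \<le> u p}"
  by (intro closed_Collect_all closed_Collect_conj closed_Collect_le continuous_on_const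
      continuous_on_product_coordinates)

text \<open>By the Weierstrass M-test the finite partial sums converge uniformly on
  \<open>K\<close>, and uniform limits preserve continuity.\<close>

lemma continuous_on_infsum_dominated:
  fixes f :: "'a \<Rightarrow> 'b::topological_space \<Rightarrow> real"
  assumes "\<And>x. continuous_on K (f x)"
    and "\<And>x y. y \<in> K \<Longrightarrow> \<bar>f x y\<bar> \<le> M x" and "M summable_on UNIV"
  shows "continuous_on K (\<lambda>y. \<Sum>\<^sub>\<infinity>x. f x y)"
proof (rule uniform_limit_theorem)
  show "uniform_limit K (\<lambda>X y. \<Sum>x\<in>X. f x y) (\<lambda>y. \<Sum>\<^sub>\<infinity>x. f x y) (finite_subsets_at_top UNIV)"
    using assms by (intro Weierstrass_m_test_general[where M = M]) auto
  show "\<forall>\<^sub>F X in finite_subsets_at_top UNIV. continuous_on K (\<lambda>y. \<Sum>x\<in>X. f x y)"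
    using assms(1) by (intro always_eventually allI continuous_on_sum)
qed simp

lemma summable_on_dominated:
  fixes f M :: "'a \<Rightarrow> real"
  assumes "\<And>x. \<bar>f x\<bar> \<le> M x" and "M summable_on UNIV"
  shows "f summable_on UNIV"
  by (rule abs_summable_summable, rule summable_on_comparison_test[OF assms(2)]) (use assms(1) in auto)

text \<open>The update adds a family supported at \<open>a\<close>, so the limit moves by its single
  nonzero term.\<close>

lemma has_sum_fun_upd:
  fixes f :: "'a \<Rightarrow> real"
  assumes "f summable_on UNIV"
  shows "(f(a := t) has_sum (infsum f UNIV + (t - f a))) UNIV"
proof -
  have "((\<lambda>x. if x = a then t - f a else 0) has_sum (t - f a)) UNIV"
    by (rule has_sum_finite_neutralI[where B = "{a}"]) auto
  from has_sum_add[OF has_sum_infsum[OF assms] this] show ?thesis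
    by (rule has_sum_cong[THEN iffD1, rotated]) auto
qed

section \<open>Flows and their induced beliefs\<close>

definition outflow :: "('e \<times> 'e \<Rightarrow> real) \<Rightarrow> 'e \<Rightarrow> real" where
  "outflow y e = (\<Sum>\<^sub>\<infinity>m. y (e, m))"

definition inflow :: "('e \<times> 'e \<Rightarrow> real) \<Rightarrow> 'e \<Rightarrow> real" where
  "inflow y m = (\<Sum>\<^sub>\<infinity>e. y (e, m))"

locale evidence_flow =
  fixes le :: "'e \<Rightarrow> 'e \<Rightarrow> bool" and g w :: "'e \<Rightarrow> real"
  assumes le_trans: "le x y \<Longrightarrow> le y z \<Longrightarrow> le x z"
    and w_pos: "0 < w e" and g_nonneg: "0 \<le> g e" and g_le_w: "g e \<le> w e"
    and w_summable: "w summable_on UNIV"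
begin

text \<open>Summability is demanded explicitly because \<open>infsum\<close> of a non-summable
  family defaults to 0, which would make the capacity bounds hold vacuously.\<close>

definition feasible :: "('e \<times> 'e \<Rightarrow> real) set" where
  "feasible = {y. (\<forall>p. 0 \<le> y p) \<and> (\<forall>e m. \<not> le m e \<longrightarrow> y (e, m) = 0) \<and>
     (\<forall>e. (\<lambda>m. y (e, m)) summable_on UNIV \<and> outflow y e \<le> w e) \<and>
     (\<forall>m. (\<lambda>e. y (e, m)) summable_on UNIV \<and> inflow y m \<le> w m)}"

definition val :: "('e \<times> 'e \<Rightarrow> real) \<Rightarrow> 'e \<Rightarrow> real" where
  "val y e = (g e + outflow y e - inflow y e) / w e"

definition energy :: "('e \<times> 'e \<Rightarrow> real) \<Rightarrow> real" where
  "energy y = (\<Sum>\<^sub>\<infinity>e. w e * (val y e)\<^sup>2)"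

definition total :: "('e \<times> 'e \<Rightarrow> real) \<Rightarrow> real" where
  "total y = (\<Sum>\<^sub>\<infinity>e. outflow y e)"

lemma feasibleD:
  assumes "y \<in> feasible"
  shows "0 \<le> y p" and "0 < y (e, m) \<Longrightarrow> le m e"
    and "(\<lambda>m. y (e, m)) summable_on UNIV" and "(\<lambda>e. y (e, m)) summable_on UNIV"
    and "outflow y e \<le> w e" and "inflow y m \<le> w m"
    and "0 \<le> outflow y e" and "0 \<le> inflow y m"
    and "y (e, m) \<le> outflow y e" and "y (e, m) \<le> inflow y m"
proof -
  show nn: "\<And>p. 0 \<le> y p" and "(\<lambda>m. y (e, m)) summable_on UNIV" "(\<lambda>e. y (e, m)) summable_on UNIV"
    and "outflow y e \<le> w e" and "inflow y m \<le> w m"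
    using assms by (auto simp: feasible_def)
  show "0 < y (e, m) \<Longrightarrow> le m e"
    using assms by (fastforce simp: feasible_def)
  show "0 \<le> outflow y e" "0 \<le> inflow y m"
    unfolding outflow_def inflow_def using nn by (auto intro: infsum_nonneg)
  show "y (e, m) \<le> outflow y e"
    using finite_sum_le_infsum[of "\<lambda>m. y (e, m)" UNIV "{m}"] nn
      \<open>(\<lambda>m. y (e, m)) summable_on UNIV\<close> by (simp add: outflow_def)
  show "y (e, m) \<le> inflow y m"
    using finite_sum_le_infsum[of "\<lambda>e. y (e, m)" UNIV "{e}"] nn
      \<open>(\<lambda>e. y (e, m)) summable_on UNIV\<close> by (simp add: inflow_def)
qed

text \<open>A product of compact intervals containing \<open>feasible\<close>: by nonnegativity an
  entry is at most its row sum and its column sum, hence at most both capacities.\<close>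

abbreviation box :: "('e \<times> 'e \<Rightarrow> real) set" where
  "box \<equiv> {y. \<forall>p. 0 \<le> y p \<and> y p \<le> (case p of (e, m) \<Rightarrow> if le m e then min (w e) (w m) else 0)}"

lemma boxD:
  assumes "y \<in> box"
  shows "\<bar>y (e, m)\<bar> \<le> w e" and "\<bar>y (e, m)\<bar> \<le> w m" and "0 \<le> y p" and "\<not> le m e \<Longrightarrow> y (e, m) = 0"
proof -
  have *: "0 \<le> y (e, m) \<and> y (e, m) \<le> (if le m e then min (w e) (w m) else 0)"
    using assms by fastforce
  show "\<bar>y (e, m)\<bar> \<le> w e" "\<bar>y (e, m)\<bar> \<le> w m" "\<not> le m e \<Longrightarrow> y (e, m) = 0"
    using * w_pos[of e] w_pos[of m] by (auto split: if_splits)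
  show "0 \<le> y p" using assms by blast
qed

section \<open>Compactness of the feasible set and continuity of the objectives\<close>

lemma continuous_on_outflow: "continuous_on box (\<lambda>y. outflow y e)"
  unfolding outflow_def using boxD(2)
  by (intro continuous_on_infsum_dominated[OF _ _ w_summable])
    (auto intro: continuous_on_subset[OF continuous_on_product_coordinates])

lemma continuous_on_inflow: "continuous_on box (\<lambda>y. inflow y m)"
  unfolding inflow_def using boxD(1)
  by (intro continuous_on_infsum_dominated[OF _ _ w_summable])
    (auto intro: continuous_on_subset[OF continuous_on_product_coordinates])

text \<open>On \<open>box\<close> every row and column is dominated by the summable
  \<open>w\<close>, so summability is automatic and only the capacity bounds remain, each a closed
  condition on \<open>box\<close>.\<close>

lemma feasible_eq:
  "feasible = box \<inter> (\<Inter>e. {y \<in> box. outflow y e \<le> w e}) \<inter> (\<Inter>m. {y \<in> box. inflow y m \<le> w m})"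
proof (intro equalityI subsetI)
  fix y assume y: "y \<in> feasible"
  have "y (e, m) \<le> w e \<and> y (e, m) \<le> w m" for e m
    using feasibleD(9)[OF y, of e m] feasibleD(5)[OF y, of e] feasibleD(6)[OF y, of m]
      feasibleD(10)[OF y, of e m] by linarith
  moreover have "y (e, m) = 0" if "\<not> le m e" for e m
    using y that by (simp add: feasible_def)
  ultimately have "y \<in> box" using feasibleD(1)[OF y] by simp
  with feasibleD(5,6)[OF y]
  show "y \<in> box \<inter> (\<Inter>e. {y \<in> box. outflow y e \<le> w e}) \<inter> (\<Inter>m. {y \<in> box. inflow y m \<le> w m})"
    by blast
next
  fix y assume y: "y \<in> box \<inter> (\<Inter>e. {y \<in> box. outflow y e \<le> w e}) \<inter> (\<Inter>m. {y \<in> box. inflow y m \<le> w m})"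
  then have b: "y \<in> box" by blast
  have "(\<lambda>m. y (e, m)) summable_on UNIV" for e
    by (rule summable_on_dominated[OF boxD(2)[OF b] w_summable])
  moreover have "(\<lambda>e. y (e, m)) summable_on UNIV" for m
    by (rule summable_on_dominated[OF boxD(1)[OF b] w_summable])
  moreover have "outflow y e \<le> w e" "inflow y e \<le> w e" for e
    using y by blast+
  ultimately show "y \<in> feasible"
    using boxD(3,4)[OF b] by (simp add: feasible_def)
qed

lemma closed_feasible: "closed feasible"
  unfolding feasible_eq
  by (intro closed_Int closed_INT ballI continuous_on_closed_Collect_le closed_function_box
      continuous_on_outflow continuous_on_inflow continuous_on_const)

lemma compact_feasible: "compact feasible"
proof -
  have "compact (box \<inter> feasible)"
    by (intro compact_Int_closed compact_function_box closed_feasible)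
  moreover have "box \<inter> feasible = feasible" unfolding feasible_eq by blast
  ultimately show ?thesis by simp
qed

lemma feasible_subset_box: "feasible \<subseteq> box"
  unfolding feasible_eq by blast

text \<open>The numerator of \<open>val\<close> lies between \<open>- w e\<close> and
  \<open>2 * w e\<close>, by the capacities and \<open>0 <= g e <= w e\<close>.\<close>

lemma abs_val_le: "y \<in> feasible \<Longrightarrow> \<bar>val y e\<bar> \<le> 2"
  using feasibleD(5,7)[of y e] feasibleD(6,8)[of y e] g_nonneg[of e] g_le_w[of e] w_pos[of e]
  by (simp add: val_def abs_le_iff field_simps)

lemma energy_term_le: "y \<in> feasible \<Longrightarrow> \<bar>w e * (val y e)\<^sup>2\<bar> \<le> 4 * w e"
  using power_mono[OF abs_val_le, of y e 2] w_pos[of e] by (simp add: abs_mult)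

lemma continuous_on_energy: "continuous_on feasible energy"
  unfolding energy_def
proof (rule continuous_on_infsum_dominated[OF _ energy_term_le])
  fix e
  show "continuous_on feasible (\<lambda>y. w e * (val y e)\<^sup>2)"
    unfolding val_def using w_pos[of e]
    by (intro continuous_intros continuous_on_subset[OF continuous_on_outflow feasible_subset_box]
        continuous_on_subset[OF continuous_on_inflow feasible_subset_box]) auto
qed (use w_summable in \<open>auto intro: summable_on_cmult_right\<close>)

lemma continuous_on_total: "continuous_on feasible total"
  unfolding total_def
  by (rule continuous_on_infsum_dominated[OF _ _ w_summable])
    (use feasibleD(5,7) in \<open>auto intro: continuous_on_subset[OF continuous_on_outflow feasible_subset_box]\<close>)

section \<open>Existence of an optimal flow\<close>

definition optimal :: "('e \<times> 'e \<Rightarrow> real) \<Rightarrow> bool" where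
  "optimal y \<longleftrightarrow> y \<in> feasible \<and> (\<forall>z\<in>feasible. energy y \<le> energy z) \<and>
     (\<forall>z\<in>feasible. energy z = energy y \<longrightarrow> total y \<le> total z)"

text \<open>The minimisers of \<open>energy\<close> form a closed sublevel set inside a compact set,
  so the continuous function \<open>total\<close> attains its minimum on them.\<close>

lemma ex_optimal: "\<exists>y. optimal y"
proof -
  have "(\<lambda>_. 0) \<in> feasible"
    using w_pos by (auto simp: feasible_def outflow_def inflow_def less_imp_le)
  then obtain y0 where y0: "y0 \<in> feasible" "\<forall>z\<in>feasible. energy y0 \<le> energy z"
    using continuous_attains_inf[OF compact_feasible _ continuous_on_energy] by blast
  let ?K = "{z \<in> feasible. energy z \<le> energy y0}"
  have "closed ?K"
    by (intro continuous_on_closed_Collect_le continuous_on_energy continuous_on_const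
        closed_feasible)
  then have "compact (feasible \<inter> ?K)" by (rule compact_Int_closed[OF compact_feasible])
  moreover have "feasible \<inter> ?K = ?K" by blast
  ultimately have "compact ?K" by simp
  moreover have "continuous_on ?K total"
    by (rule continuous_on_subset[OF continuous_on_total]) auto
  ultimately obtain y where "y \<in> ?K" "\<forall>z\<in>?K. total y \<le> total z"
    using continuous_attains_inf[of ?K total] y0 by blast
  with y0 show ?thesis unfolding optimal_def by (intro exI[of _ y]) (auto intro: order_trans)
qed

section \<open>Perturbing a single entry\<close>

lemma summable_upd:
  fixes y :: "'e \<times> 'e \<Rightarrow> real"
  shows "(\<lambda>m. y (e, m)) summable_on UNIV \<Longrightarrow> (\<lambda>m. (y((a, c) := t)) (e, m)) summable_on UNIV"
    and "(\<lambda>m. y (m, e)) summable_on UNIV \<Longrightarrow> (\<lambda>m. (y((a, c) := t)) (m, e)) summable_on UNIV"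
proof -
  have *: "(\<lambda>m. (y((a, c) := t)) (e, m)) = (if e = a then (\<lambda>m. y (e, m))(c := t) else (\<lambda>m. y (e, m)))"
    "(\<lambda>m. (y((a, c) := t)) (m, e)) = (if e = c then (\<lambda>m. y (m, e))(a := t) else (\<lambda>m. y (m, e)))"
    by auto
  show "(\<lambda>m. y (e, m)) summable_on UNIV \<Longrightarrow> (\<lambda>m. (y((a, c) := t)) (e, m)) summable_on UNIV"
    unfolding * using has_sum_fun_upd[of "\<lambda>m. y (e, m)" c t] by (auto simp: has_sum_iff)
  show "(\<lambda>m. y (m, e)) summable_on UNIV \<Longrightarrow> (\<lambda>m. (y((a, c) := t)) (m, e)) summable_on UNIV"
    unfolding * using has_sum_fun_upd[of "\<lambda>m. y (m, e)" a t] by (auto simp: has_sum_iff)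
qed

lemma outflow_upd:
  assumes "(\<lambda>m. y (e, m)) summable_on UNIV"
  shows "outflow (y((a, c) := t)) e = outflow y e + (if e = a then t - y (a, c) else 0)"
proof -
  have "(\<lambda>m. (y((a, c) := t)) (e, m)) = (if e = a then (\<lambda>m. y (e, m))(c := t) else (\<lambda>m. y (e, m)))"
    by auto
  with has_sum_fun_upd[OF assms, of c t] show ?thesis
    by (auto simp: outflow_def has_sum_iff)
qed

lemma inflow_upd:
  assumes "(\<lambda>e. y (e, m)) summable_on UNIV"
  shows "inflow (y((a, c) := t)) m = inflow y m + (if m = c then t - y (a, c) else 0)"
proof -
  have "(\<lambda>e. (y((a, c) := t)) (e, m)) = (if m = c then (\<lambda>e. y (e, m))(a := t) else (\<lambda>e. y (e, m)))"
    by auto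
  with has_sum_fun_upd[OF assms, of a t] show ?thesis
    by (auto simp: inflow_def has_sum_iff)
qed

text \<open>Only the terms at \<open>a\<close> and \<open>c\<close> change: \<open>val\<close> rises
  by \<open>t / w a\<close> at the emitter and falls by \<open>t / w c\<close> at the recipient. The
  energy difference is thus a finite sum, and its expansion is exact, with no remainder.\<close>

lemma energy_perturb:
  assumes y: "y \<in> feasible" and "a \<noteq> c"
    and z: "z = y((a, c) := y (a, c) + t)"
  shows "energy z = energy y + (2 * t * (val y a - val y c) + t\<^sup>2 * (1 / w a + 1 / w c))"
proof -
  note s = feasibleD(3,4)[OF y]
  have v: "val z e = val y e + (if e = a then t / w a else if e = c then - t / w c else 0)" for e
    using \<open>a \<noteq> c\<close> s by (auto simp: val_def z outflow_upd inflow_upd diff_divide_distrib add_divide_distrib)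
  have "(\<lambda>e. w e * (val y e)\<^sup>2) summable_on UNIV"
    using energy_term_le[OF y] by (rule summable_on_dominated) (intro summable_on_cmult_right w_summable)
  then have 1: "((\<lambda>e. w e * (val y e)\<^sup>2) has_sum energy y) UNIV"
    by (simp add: energy_def)
  have "((\<lambda>e. w e * (val z e)\<^sup>2 - w e * (val y e)\<^sup>2) has_sum
      (\<Sum>e\<in>{a, c}. w e * (val z e)\<^sup>2 - w e * (val y e)\<^sup>2)) UNIV"
    by (rule has_sum_finite_neutralI[where B = "{a, c}"]) (auto simp: v)
  from has_sum_add[OF 1 this]
  have "energy z = energy y + (\<Sum>e\<in>{a, c}. w e * (val z e)\<^sup>2 - w e * (val y e)\<^sup>2)"
    by (auto simp: energy_def dest: infsumI)
  also have "(\<Sum>e\<in>{a, c}. w e * (val z e)\<^sup>2 - w e * (val y e)\<^sup>2) =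
      2 * t * (val y a - val y c) + t\<^sup>2 * (1 / w a + 1 / w c)"
    using \<open>a \<noteq> c\<close> w_pos[of a] w_pos[of c]
    by (simp add: v power2_eq_square field_simps)
  finally show ?thesis .
qed

lemma feasible_upd:
  assumes y: "y \<in> feasible" and "0 \<le> t" and "le c a"
    and "outflow y a + t - y (a, c) \<le> w a" and "inflow y c + t - y (a, c) \<le> w c"
  shows "y((a, c) := t) \<in> feasible"
  using assms feasibleD[OF y] summable_upd
  unfolding feasible_def by (auto simp: outflow_upd inflow_upd algebra_simps)


section \<open>Consequences of least volume\<close>

lemma total_decrease:
  assumes y: "y \<in> feasible" and "outflow z = (outflow y)(e := outflow y e - t)"
  shows "total z = total y - t"
proof -
  have "outflow y summable_on UNIV"
    using feasibleD(5,7)[OF y] by (intro summable_on_dominated[OF _ w_summable]) auto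
  from has_sum_fun_upd[OF this, of e "outflow y e - t"] show ?thesis
    unfolding total_def assms(2) by (auto dest: infsumI)
qed

text \<open>Cutting inflow and outflow at \<open>e\<close> by the same amount leaves every
  \<open>val\<close>, and hence the energy, unchanged. A positive \<open>t\<close> would then
  contradict the minimality of \<open>total\<close>.\<close>

lemma optimal_no_relay:
  assumes "optimal y" and "z \<in> feasible"
    and "outflow z = (outflow y)(e := outflow y e - t)"
    and "inflow z = (inflow y)(e := inflow y e - t)"
  shows "t \<le> 0"
proof -
  have "val z = val y" using assms(3,4) by (auto simp: val_def)
  then have "energy z = energy y" by (simp add: energy_def)
  moreover have "total z = total y - t"
    using assms by (auto intro: total_decrease simp: optimal_def)
  ultimately show ?thesis using assms(1,2) by (force simp: optimal_def)
qed

text \<open>A loop at \<open>e\<close> counts once as outflow and once as inflow, so deleting it is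
  a cut to which \<open>optimal_no_relay\<close> applies.\<close>

lemma optimal_self:
  assumes "optimal y"
  shows "y (e, e) = 0"
proof (rule ccontr)
  assume "y (e, e) \<noteq> 0"
  have y: "y \<in> feasible" using assms by (simp add: optimal_def)
  with \<open>y (e, e) \<noteq> 0\<close> have pos: "0 < y (e, e)" using feasibleD(1)[OF y, of "(e, e)"] by simp
  let ?z = "y((e, e) := 0)"
  have "?z \<in> feasible"
    using feasibleD(2,5,6)[OF y] pos
    by (intro feasible_upd[OF y])
      (auto intro: add_increasing2 order_trans[of _ "outflow y e"] order_trans[of _ "inflow y e"])
  then have "y (e, e) \<le> 0"
    by (rule optimal_no_relay[OF assms, where e = e])
      (use feasibleD(3,4)[OF y] in \<open>auto simp: fun_eq_iff outflow_upd inflow_upd\<close>)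
  with pos show False by simp
qed

lemma ex_pos_flow:
  assumes "y \<in> feasible"
  shows "0 < inflow y m \<Longrightarrow> \<exists>e. 0 < y (e, m)" and "0 < outflow y e \<Longrightarrow> \<exists>m. 0 < y (e, m)"
proof -
  show "\<exists>e. 0 < y (e, m)" if "0 < inflow y m"
  proof (rule ccontr)
    assume "\<not> ?thesis"
    then have "\<forall>e. y (e, m) = 0"
      using feasibleD(1)[OF assms] by (meson antisym_conv1 linorder_not_less)
    with that show False by (simp add: inflow_def)
  qed
  show "\<exists>m. 0 < y (e, m)" if "0 < outflow y e"
  proof (rule ccontr)
    assume "\<not> ?thesis"
    then have "\<forall>m. y (e, m) = 0"
      using feasibleD(1)[OF assms] by (meson antisym_conv1 linorder_not_less)
    with that show False by (simp add: outflow_def)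
  qed
qed

text \<open>Flow passing through \<open>e\<close> can be short-cut by transitivity.\<close>

lemma optimal_bipartite:
  assumes opt: "optimal y"
  shows "inflow y e = 0 \<or> outflow y e = 0"
proof (rule ccontr)
  assume "\<not> ?thesis"
  have y: "y \<in> feasible" using assms by (simp add: optimal_def)
  with \<open>\<not> ?thesis\<close> have "0 < inflow y e" "0 < outflow y e"
    using feasibleD(7,8)[OF y] by (simp_all add: order_less_le)
  with ex_pos_flow[OF y] obtain a c where a: "0 < y (a, e)" and c: "0 < y (e, c)" by blast
  then have ne: "a \<noteq> e" "e \<noteq> c" using optimal_self[OF opt] by auto
  \<comment> \<open>This is the largest amount that can be taken off both legs \<open>a\<close> to
    \<open>e\<close> and \<open>e\<close> to \<open>c\<close>. Both legs are reduced before
    \<open>t\<close> is sent directly from \<open>a\<close> to \<open>c\<close>, so the capacities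
    at \<open>a\<close> and \<open>c\<close> have room for it.\<close>
  define t where "t = min (y (a, e)) (y (e, c))"
  have t: "0 < t" "t \<le> y (a, e)" "t \<le> y (e, c)" using a c by (auto simp: t_def)
  define z1 where "z1 = y((a, e) := y (a, e) - t)"
  define z2 where "z2 = z1((e, c) := z1 (e, c) - t)"
  define z where "z = z2((a, c) := z2 (a, c) + t)"
  have z1: "z1 \<in> feasible" unfolding z1_def
    using t feasibleD(2)[OF y a] feasibleD(5)[OF y, of a] feasibleD(6)[OF y, of e]
    by (intro feasible_upd[OF y]) auto
  have "z1 (e, c) = y (e, c)" using ne by (simp add: z1_def)
  then have z2: "z2 \<in> feasible" unfolding z2_def
    using t feasibleD(2)[OF y c] feasibleD(5)[OF z1, of e] feasibleD(6)[OF z1, of c]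
    by (intro feasible_upd[OF z1]) auto
  have out1: "outflow z1 = (outflow y)(a := outflow y a - t)"
    and in1: "inflow z1 = (inflow y)(e := inflow y e - t)"
    unfolding z1_def using feasibleD(3,4)[OF y] by (auto simp: fun_eq_iff outflow_upd inflow_upd)
  have out2: "outflow z2 = (outflow z1)(e := outflow z1 e - t)"
    and in2: "inflow z2 = (inflow z1)(c := inflow z1 c - t)"
    unfolding z2_def using feasibleD(3,4)[OF z1] by (auto simp: fun_eq_iff outflow_upd inflow_upd)
  have out3: "outflow z = (outflow z2)(a := outflow z2 a + t)"
    and in3: "inflow z = (inflow z2)(c := inflow z2 c + t)"
    unfolding z_def using feasibleD(3,4)[OF z2] by (auto simp: fun_eq_iff outflow_upd inflow_upd)
  have "outflow z2 a + t \<le> w a" "inflow z2 c + t \<le> w c"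
    using ne feasibleD(5,6)[OF y] by (auto simp: out1 out2 in1 in2)
  then have "z \<in> feasible" unfolding z_def
    using t le_trans[OF feasibleD(2)[OF y c] feasibleD(2)[OF y a]] feasibleD(1)[OF z2, of "(a, c)"]
    by (intro feasible_upd[OF z2]) auto
  then have "t \<le> 0"
    by (rule optimal_no_relay[OF opt, where e = e]) (use ne in \<open>auto simp: out1 out2 out3 in1 in2 in3\<close>)
  with t show False by simp
qed

section \<open>First-order conditions\<close>

lemma slope_nonneg:
  fixes C D T :: real
  assumes "0 < T" "0 < C" and *: "\<And>t. 0 < t \<Longrightarrow> t \<le> T \<Longrightarrow> 0 \<le> 2 * t * D + t\<^sup>2 * C"
  shows "0 \<le> D"
proof (rule ccontr)
  assume "\<not> 0 \<le> D"
  \<comment> \<open>At this step size the quadratic term offsets at most half of the linear one: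
    \<open>2 * D + t * C <= D < 0\<close>.\<close>
  define t where "t = min T (- D / C)"
  have t: "0 < t" "t \<le> T" "t * C \<le> - D"
    using assms(1,2) \<open>\<not> 0 \<le> D\<close> by (auto simp: t_def field_simps min_def)
  have "0 \<le> t * (2 * D + t * C)"
    using *[OF t(1,2)] by (simp add: power2_eq_square algebra_simps)
  then have "0 \<le> 2 * D + t * C" using t(1) by (simp add: zero_le_mult_iff)
  with t(3) \<open>\<not> 0 \<le> D\<close> show False by linarith
qed

text \<open>A positive entry may be reduced by any \<open>t\<close> up to its size. The energy
  cannot fall, so the linear coefficient \<open>val y m - val y e\<close> is nonnegative.\<close>

lemma optimal_val_flow_le:
  assumes opt: "optimal y" and pos: "0 < y (e, m)"
  shows "val y e \<le> val y m"
proof -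
  have y: "y \<in> feasible" using opt by (simp add: optimal_def)
  have ne: "e \<noteq> m" using optimal_self[OF opt] pos by auto
  have "0 \<le> val y m - val y e"
  proof (rule slope_nonneg[OF pos])
    show "0 < 1 / w e + 1 / w m" using w_pos by (simp add: add_pos_pos)
    fix t assume t: "0 < t" "t \<le> y (e, m)"
    let ?z = "y((e, m) := y (e, m) + - t)"
    have "?z \<in> feasible"
      using t feasibleD(2)[OF y pos] feasibleD(5)[OF y, of e] feasibleD(6)[OF y, of m]
      by (intro feasible_upd[OF y]) auto
    then have "energy y \<le> energy ?z" using opt unfolding optimal_def by blast
    with energy_perturb[OF y ne refl, of "- t"]
    show "0 \<le> 2 * t * (val y m - val y e) + t\<^sup>2 * (1 / w e + 1 / w m)"
      by (simp add: algebra_simps)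
  qed
  then show ?thesis by simp
qed

lemma optimal_val_slack_le:
  assumes opt: "optimal y" and "le m e" and slack: "outflow y e < w e" "inflow y m < w m"
  shows "val y m \<le> val y e"
proof (cases "e = m")
  case False
  have y: "y \<in> feasible" using opt by (simp add: optimal_def)
  \<comment> \<open>The spare capacity at both ends bounds how much flow can be added from
    \<open>e\<close> to \<open>m\<close>; adding it reverses the sign of the first-order
    condition.\<close>
  define T where "T = min (w e - outflow y e) (w m - inflow y m)"
  have "0 \<le> val y e - val y m"
  proof (rule slope_nonneg)
    show "0 < T" using slack by (simp add: T_def)
    show "0 < 1 / w e + 1 / w m" using w_pos by (simp add: add_pos_pos)
    fix t assume t: "0 < t" "t \<le> T"
    let ?z = "y((e, m) := y (e, m) + t)"
    have "?z \<in> feasible"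
      using t \<open>le m e\<close> feasibleD(1)[OF y, of "(e, m)"]
      by (intro feasible_upd[OF y]) (auto simp: T_def)
    then have "energy y \<le> energy ?z" using opt unfolding optimal_def by blast
    with energy_perturb[OF y False refl, of t]
    show "0 \<le> 2 * t * (val y e - val y m) + t\<^sup>2 * (1 / w e + 1 / w m)" by simp
  qed
  then show ?thesis by simp
qed simp

text \<open>Without inflow the numerator is a sum of nonnegative terms. Otherwise some
  \<open>a\<close> emits to \<open>e\<close>; it has no inflow by \<open>optimal_bipartite\<close>,
  and \<open>val y a <= val y e\<close>.\<close>

lemma optimal_val_nonneg:
  assumes opt: "optimal y"
  shows "0 \<le> val y e"
proof -
  have y: "y \<in> feasible" using opt by (simp add: optimal_def)
  have *: "0 \<le> val y a" if "inflow y a = 0" for a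
    using that g_nonneg[of a] w_pos[of a] feasibleD(7)[OF y, of a] by (simp add: val_def)
  show ?thesis
  proof (cases "inflow y e = 0")
    case False
    then obtain a where a: "0 < y (a, e)"
      using ex_pos_flow(1)[OF y, of e] feasibleD(8)[OF y, of e] by (auto simp: order_less_le)
    then have "inflow y a = 0"
      using optimal_bipartite[OF opt, of a] feasibleD(9)[OF y, of a e] by auto
    from *[OF this] optimal_val_flow_le[OF opt a] show ?thesis by simp
  qed (rule *)
qed

text \<open>Dual argument: without outflow the numerator is at most \<open>g e\<close>; otherwise
  compare \<open>e\<close> with a recipient of its flow, which emits nothing.\<close>

lemma optimal_val_le_1:
  assumes opt: "optimal y"
  shows "val y e \<le> 1"
proof -
  have y: "y \<in> feasible" using opt by (simp add: optimal_def)
  have *: "val y a \<le> 1" if "outflow y a = 0" for a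
    using that g_le_w[of a] w_pos[of a] feasibleD(8)[OF y, of a] by (simp add: val_def)
  show ?thesis
  proof (cases "outflow y e = 0")
    case False
    then obtain m where m: "0 < y (e, m)"
      using ex_pos_flow(2)[OF y, of e] feasibleD(7)[OF y, of e] by (auto simp: order_less_le)
    then have "outflow y m = 0"
      using optimal_bipartite[OF opt, of m] feasibleD(10)[OF y, of e m] by auto
    from *[OF this] optimal_val_flow_le[OF opt m] show ?thesis by simp
  qed (rule *)
qed

text \<open>Binding outflow at \<open>e\<close> forces \<open>val y e \<ge> 1\<close> and binding inflow at \<open>m\<close> forces
  \<open>val y m \<le> 0\<close>, so the capacities never obstruct monotonicity.\<close>

lemma optimal_val_mono:
  assumes opt: "optimal y" and "le m e"
  shows "val y m \<le> val y e"
proof -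
  have y: "y \<in> feasible" using opt by (simp add: optimal_def)
  consider "outflow y e < w e" "inflow y m < w m" | "outflow y e = w e" | "inflow y m = w m"
    using feasibleD(5)[OF y, of e] feasibleD(6)[OF y, of m] by fastforce
  then show ?thesis
  proof cases
    case 1
    with assms show ?thesis by (rule optimal_val_slack_le)
  next
    case 2
    then have "1 \<le> val y e"
      using optimal_bipartite[OF opt, of e] w_pos[of e] g_nonneg[of e] by (simp add: val_def)
    with optimal_val_le_1[OF opt, of m] show ?thesis by simp
  next
    case 3
    then have "val y m \<le> 0"
      using optimal_bipartite[OF opt, of m] w_pos[of m] g_le_w[of m]
      by (simp add: val_def divide_le_0_iff)
    with optimal_val_nonneg[OF opt, of e] show ?thesis by simp
  qed
qed

lemma optimal_val_flow_eq:
  assumes "optimal y" and "0 < y (e, m)"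
  shows "val y e = val y m"
proof -
  have "y \<in> feasible" using assms(1) by (simp add: optimal_def)
  then have "le m e" by (rule feasibleD(2)) (rule assms(2))
  with optimal_val_flow_le[OF assms] optimal_val_mono[OF assms(1)] show ?thesis by force
qed

end

section \<open>Unordered sums and probability mass functions\<close>

lemma ex_pmf_of_has_sum:
  fixes f :: "'a \<Rightarrow> real"
  assumes "\<And>x. 0 \<le> f x" and "(f has_sum 1) UNIV"
  shows "\<exists>p. pmf p = f"
proof -
  have "f summable_on UNIV" and 1: "infsum f UNIV = 1"
    using assms(2) by (auto simp: has_sum_iff)
  then have "(\<lambda>x. norm (f x)) summable_on UNIV" using assms(1) by simp
  \<comment> \<open>\<open>embed_pmf\<close> asks for an integral over the counting measure;
    \<open>infsetsum\<close> is the bridge from \<open>infsum\<close> to it.\<close>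
  then have *: "Infinite_Set_Sum.abs_summable_on f UNIV"
    by (rule abs_summable_equivalent[THEN iffD1])
  have "(\<integral>\<^sup>+x. ennreal (f x) \<partial>count_space UNIV) = 1"
    using nn_integral_conv_infsetsum[OF * assms(1)] infsetsum_infsum[OF *] 1 by simp
  then show ?thesis using assms(1) by (intro exI[of _ "embed_pmf f"] ext pmf_embed_pmf) auto
qed

lemma pmf_summable_on: "pmf p summable_on A"
  by (rule abs_summable_summable, rule abs_summable_equivalent[THEN iffD2, OF pmf_abs_summable])

section \<open>From the optimal flow to an equilibrium\<close>

theorem theorem4:
  fixes pi0 :: real and FG FB :: "'e::countable pmf"
    and le :: "'e \<Rightarrow> 'e \<Rightarrow> bool" and uR :: "real \<Rightarrow> state \<Rightarrow> real"
  assumes "0 < pi0" and "pi0 < 1"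
    and "\<forall>e. pmf FG e > 0 \<or> pmf FB e > 0"
    and "disclosure_rule le"
    and "\<forall>mu\<in>{0..1}. \<exists>!a. \<forall>a'. exp_util uR mu a' \<le> exp_util uR mu a"
    and "strict_mono_on {0..1} (phi uR)"
    and "\<forall>A. connected_pre le A \<longrightarrow> finite (minimal_elems le A)"
  shows "\<exists>sg astar mu. equilibrium pi0 FG FB le uR sg astar mu"
proof -
  define g where "g e = pmf FG e * pi0" for e
  define w where "w e = pmf FG e * pi0 + pmf FB e * (1 - pi0)" for e
  have le_refl: "le e e" for e using assms(4) by (simp add: disclosure_rule_def)
  have w_pos: "0 < w e" for e
  proof -
    have "0 < pmf FG e * pi0 \<or> 0 < pmf FB e * (1 - pi0)"
      using assms(1-3) mult_pos_pos[of "pmf FG e" pi0] mult_pos_pos[of "pmf FB e" "1 - pi0"]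
      by force
    moreover have "0 \<le> pmf FG e * pi0" "0 \<le> pmf FB e * (1 - pi0)"
      using assms(1,2) by simp_all
    ultimately show ?thesis unfolding w_def by linarith
  qed
  interpret evidence_flow le g w
  proof
    show "le x z" if "le x y" "le y z" for x y z
      using that assms(4) unfolding disclosure_rule_def by blast
    show "w summable_on UNIV"
      unfolding w_def by (intro summable_on_add summable_on_cmult_left pmf_summable_on)
  qed (use assms(1,2) w_pos in \<open>auto simp: g_def w_def\<close>)
  obtain y where opt: "optimal y" using ex_optimal by blast
  then have y: "y \<in> feasible" by (simp add: optimal_def)
  define v where "v = val y"
  \<comment> \<open>These are the types that conceal their evidence; they receive no flow, so nobody
    sends them as messages.\<close>
  define S where "S = {e. outflow y e > 0}"
  have out0: "e \<notin> S \<Longrightarrow> outflow y e = 0" and in0: "e \<in> S \<Longrightarrow> inflow y e = 0" for e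
    using feasibleD(7)[OF y, of e] optimal_bipartite[OF opt, of e] by (auto simp: S_def)
  have v_eq: "v e * w e = g e + outflow y e - inflow y e" for e
    using w_pos[of e] by (simp add: v_def val_def)
  have flow: "e \<in> S" "m \<notin> S" "le m e" "v e = v m" if "0 < y (e, m)" for e m
    using that feasibleD(2,9,10)[OF y, of e m] optimal_val_flow_eq[OF opt, of e m] in0[of m]
    by (auto simp: S_def v_def)
  have nu_eq: "nu pi0 FG FB {m} = g m / w m" for m
    by (simp add: nu_def g_def w_def measure_pmf_single)
  have nu_range: "g m / w m \<in> {0..1}" for m
    using g_nonneg[of m] g_le_w[of m] w_pos[of m] by simp
  have v_range: "v m \<in> {0..1}" for m
    using optimal_val_nonneg[OF opt] optimal_val_le_1[OF opt] by (simp add: v_def)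
  \<comment> \<open>Strictness here makes concealment strictly profitable on \<open>S\<close>, as
    the truth-leaning condition requires.\<close>
  have nu_less: "g m / w m < v m" if "m \<in> S" for m
    using that v_eq[of m] in0[of m] w_pos[of m] by (simp add: S_def field_simps)

  \<comment> \<open>Strategy, beliefs and incentives\<close>
  have "\<exists>p. pmf p = (\<lambda>m. y (e, m) / outflow y e)" if "e \<in> S" for e
  proof (rule ex_pmf_of_has_sum)
    show "((\<lambda>m. y (e, m) / outflow y e) has_sum 1) UNIV"
      using has_sum_cmult_left[OF has_sum_infsum[OF feasibleD(3)[OF y]], of e "1 / outflow y e"] that
      by (simp add: outflow_def[symmetric] S_def)
  qed (use feasibleD(1,7)[OF y] in auto)
  then obtain p where p: "\<And>e. e \<in> S \<Longrightarrow> pmf (p e) = (\<lambda>m. y (e, m) / outflow y e)"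
    by metis
  define sg where "sg e = (if e \<in> S then p e else return_pmf e)" for e
  \<comment> \<open>Messages in \<open>S\<close> are off path and must carry their own posterior
    \<open>nu\<close>, which is \<open>g m / w m\<close>; the others carry \<open>v m\<close>, still
    to be matched with Bayes' rule.\<close>
  define mu where "mu m = (if m \<in> S then g m / w m else v m)" for m
  define astar where "astar m = phi uR (mu m)" for m
  have mu_range: "mu m \<in> {0..1}" for m
    using nu_range v_range by (simp add: mu_def)
  have astar_le: "astar m \<le> astar m' \<longleftrightarrow> mu m \<le> mu m'" for m m'
    unfolding astar_def by (rule strict_mono_on_less_eq[OF assms(6) mu_range mu_range])
  have mu_le_v: "mu m \<le> v m" for m
    using nu_less[of m] by (auto simp: mu_def)
  have supp: "le m e \<and> m \<notin> S \<and> v m = v e" if "m \<in> set_pmf (sg e)" for m e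
  proof (cases "e \<in> S")
    case True
    with that have "y (e, m) \<noteq> 0" by (auto simp: sg_def set_pmf_iff p)
    then have "0 < y (e, m)" using feasibleD(1)[OF y, of "(e, m)"] by simp
    then show ?thesis using flow[of e m] by simp
  next
    case False
    with that show ?thesis using le_refl by (auto simp: sg_def)
  qed
  have on_path_iff: "on_path sg m \<longleftrightarrow> m \<notin> S" for m
  proof
    show "on_path sg m" if "m \<notin> S"
      unfolding on_path_def using that by (intro exI[of _ m]) (simp add: sg_def)
  qed (use supp in \<open>auto simp: on_path_def\<close>)
  \<comment> \<open>The chain is \<open>mu m' <= v m' <= v e = v m = mu m\<close>, the last equality
    because messages sent lie outside \<open>S\<close>.\<close>
  have best: "mu m' \<le> mu m" if "m \<in> set_pmf (sg e)" "le m' e" for e m m'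
    using mu_le_v[of m'] optimal_val_mono[OF opt that(2)] supp[OF that(1)] by (simp add: mu_def v_def)

  \<comment> \<open>Bayes' rule on path\<close>
  have bayes: "mu m = (\<Sum>\<^sub>\<infinity>e\<in>{e. le m e}. pmf (sg e) m * pmf FG e * pi0) /
     (\<Sum>\<^sub>\<infinity>e\<in>{e. le m e}. pmf (sg e) m * (pmf FG e * pi0 + pmf FB e * (1 - pi0)))"
    if m: "m \<notin> S" for m
  proof -
    define q where "q e = pmf (sg e) m" for e
    \<comment> \<open>Since \<open>q\<close> vanishes outside the upper contour set of
      \<open>m\<close>, both sums may run over all evidence.\<close>
    have q0: "q e = 0" if "\<not> le m e" for e
      using that supp[of m e] by (auto simp: q_def set_pmf_iff)
    have num: "(\<Sum>\<^sub>\<infinity>e\<in>{e. le m e}. pmf (sg e) m * pmf FG e * pi0) = (\<Sum>\<^sub>\<infinity>e. q e * g e)"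
      by (rule infsum_cong_neutral) (use q0 in \<open>auto simp: q_def g_def\<close>)
    have den: "(\<Sum>\<^sub>\<infinity>e\<in>{e. le m e}. pmf (sg e) m * (pmf FG e * pi0 + pmf FB e * (1 - pi0))) =
        (\<Sum>\<^sub>\<infinity>e. q e * w e)"
      by (rule infsum_cong_neutral) (use q0 in \<open>auto simp: q_def w_def\<close>)
    have "\<bar>q e * w e\<bar> \<le> w e" for e
      using w_pos[of e] pmf_le_1[of "sg e" m] by (simp add: q_def abs_mult)
    then have qw: "(\<lambda>e. q e * w e) summable_on UNIV"
      by (rule summable_on_dominated[OF _ w_summable])
    \<comment> \<open>a sender \<open>e\<close> of \<open>m\<close> has \<open>g e = v m * w e - outflow y e\<close>, while \<open>m\<close> itself has the surplus \<open>inflow y m\<close>\<close>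
    have split: "q e * g e = v m * (q e * w e) + - 1 * y (e, m) + (if e = m then inflow y m else 0)" for e
    proof (cases "e \<in> S")
      case True
      show ?thesis
      proof (cases "y (e, m) = 0")
        case False
        then have "v e = v m" using flow(4)[of e m] feasibleD(1)[OF y, of "(e, m)"] by simp
        then have g: "g e = v m * w e - outflow y e" using v_eq[of e] in0[OF True] by simp
        have q: "q e = y (e, m) / outflow y e" using True by (simp add: q_def sg_def p)
        have "e \<noteq> m" "outflow y e \<noteq> 0" using True m by (auto simp: S_def)
        then show ?thesis by (simp add: g q right_diff_distrib)
      qed (use True m in \<open>auto simp: q_def sg_def p\<close>)
    next
      case False
      then have "y (e, m) = 0"
        using feasibleD(1)[OF y, of "(e, m)"] feasibleD(9)[OF y, of e m] out0[of e] by simp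
      with False show ?thesis
        using v_eq[of m] out0[of m] by (auto simp: q_def sg_def)
    qed
    \<comment> \<open>The deductions \<open>y (e, m)\<close> sum to \<open>inflow y m\<close> and
      cancel the surplus of \<open>m\<close> itself.\<close>
    have "((\<lambda>e. v m * (q e * w e) + - 1 * y (e, m) + (if e = m then inflow y m else 0)) has_sum
        (v m * (\<Sum>\<^sub>\<infinity>e. q e * w e) + - 1 * inflow y m + inflow y m)) UNIV"
    proof (intro has_sum_add has_sum_cmult_right has_sum_infsum qw)
      show "((\<lambda>e. y (e, m)) has_sum inflow y m) UNIV"
        unfolding inflow_def by (rule has_sum_infsum[OF feasibleD(4)[OF y]])
      show "((\<lambda>e. if e = m then inflow y m else 0) has_sum inflow y m) UNIV"
        by (rule has_sum_finite_neutralI[where B = "{m}"]) auto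
    qed
    then have "(\<Sum>\<^sub>\<infinity>e. q e * g e) = v m * (\<Sum>\<^sub>\<infinity>e. q e * w e)"
      unfolding split by (auto dest: infsumI)
    \<comment> \<open>\<open>m\<close> discloses itself with probability 1, so its own mass
      \<open>w m\<close> bounds the denominator from below.\<close>
    moreover have "0 < (\<Sum>\<^sub>\<infinity>e. q e * w e)"
    proof -
      have "q m = 1" using m by (simp add: q_def sg_def)
      then have "w m \<le> (\<Sum>\<^sub>\<infinity>e. q e * w e)"
        using finite_sum_le_infsum[OF qw, of "{m}"] w_pos by (simp add: q_def less_imp_le)
      with w_pos[of m] show ?thesis by simp
    qed
    ultimately show ?thesis unfolding num den using m by (simp add: mu_def)
  qed
  have truth: "pmf (sg e) e = 1" if "\<And>m. le m e \<Longrightarrow> astar m \<le> astar e" for e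
  proof (cases "e \<in> S")
    case True
    \<comment> \<open>Any message sent from \<open>e\<close> in \<open>S\<close> has belief
      \<open>v e\<close>, strictly above \<open>g e / w e = mu e\<close>, so truth cannot be a best
      reply there.\<close>
    obtain m where m: "m \<in> set_pmf (sg e)" using set_pmf_not_empty by fast
    then have "mu m \<le> mu e" using that[of m] supp astar_le by blast
    with supp[OF m] nu_less[OF True] True show ?thesis by (simp add: mu_def)
  qed (simp add: sg_def)
  have "equilibrium pi0 FG FB le uR sg astar mu"
    unfolding equilibrium_def on_path_iff
  proof (intro conjI allI ballI impI)
    show "mu m = nu pi0 FG FB {m}" if "\<not> m \<notin> S" for m
      using that by (simp add: mu_def nu_eq)
    show "pmf (sg e) e = 1" if "\<forall>m. le m e \<longrightarrow> astar m \<le> astar e" for e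
      using that truth by blast
    show "le m e" if "m \<in> set_pmf (sg e)" for e m
      using supp[OF that] by blast
    show "astar m' \<le> astar m" if "m \<in> set_pmf (sg e)" "le m' e" for e m m'
      using best[OF that] by (simp add: astar_le)
  qed (rule mu_range astar_def bayes, assumption?)+
  then show ?thesis by blast
qed

end
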